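(* Let $g\geqslant1$, let $f\in\mathbb{C}[x]$ with $\deg f\leqslant 2g+1$ and $f(0)=1$, and let $(\mathcal{P},\mathcal{Q},\mathcal{R})\in\mu^{-1}(f)$ be a generic triplet, with coefficients $p_k,q_k,r_k$. Let $(w_n)_{n\geqslant1}$ be the sequence generated from it by the Volterra map. Then for all $n\geqslant1$ $$w_n=\frac{\Delta_{n-3}\Delta_n}{\Delta_{n-2}\Delta_{n-1}},$$ where $\Delta_{-2}=\Delta_{-1}=\Delta_0=1$ and, for $k\geqslant1$, $\Delta_{2k-1}=\det(s_{i+j-1})_{i,j=1,\dots,k}$ and $\Delta_{2k}=\det(s_{i+j})_{i,j=1,\dots,k}$, and where the entries $s_j$ satisfy the recursion $$s_j=\sum_{k=1}^g(p_k-q_k)s_{j-k}+\sum_{i=1}^{j-1}s_is_{j-i}+\frac12\sum_{k=1}^gq_k\sum_{i=1}^{j-k-1}s_is_{j-k-i},\qquad j\geqslant g+2,$$ the initial values $s_1,\dots,s_{g+1}$ (and the coefficients of the recursion) being determined by the triplet $(\mathcal{P},\mathcal{Q},\mathcal{R})$.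
   Context: $M_g$ is the affine space of triplets $(\mathcal{P},\mathcal{Q},\mathcal{R})$ of complex polynomials $\mathcal{P}=1+\sum_{i=1}^gp_ix^i$, $\mathcal{Q}=2+\sum_{i=1}^gq_ix^i$, $\mathcal{R}=\sum_{i=1}^{g+1}r_ix^i$, and $\mu(\mathcal{P},\mathcal{Q},\mathcal{R})=\mathcal{P}^2+\mathcal{Q}\mathcal{R}$. The Volterra map $\mathcal{V}_g$ sends $(\mathcal{P},\mathcal{Q},\mathcal{R})$ to $(\tilde{\mathcal{P}},\tilde{\mathcal{Q}},\tilde{\mathcal{R}})$ with $\tilde{\mathcal{P}}=\mathcal{Q}-\mathcal{P}$, $\tilde{\mathcal{Q}}=\frac{2\mathcal{P}-\mathcal{Q}+\mathcal{R}}{-wx}$, $\tilde{\mathcal{R}}=-wx\mathcal{Q}$, where $w=-\frac12(2p_1-q_1+r_1)$ must be non-zero; it preserves the fibers of $\mu$. Put $(\mathcal{P}_0,\mathcal{Q}_0,\mathcal{R}_0)=(\mathcal{P},\mathcal{Q},\mathcal{R})$, $(\mathcal{P}_{n+1},\mathcal{Q}_{n+1},\mathcal{R}_{n+1})=\mathcal{V}_g(\mathcal{P}_n,\mathcal{Q}_n,\mathcal{R}_n)$, and let $w_{n+1}=-\frac12(2p_{n,1}-q_{n,1}+r_{n,1})$ be the value of $w$ at $(\mathcal{P}_n,\mathcal{Q}_n,\mathcal{R}_n)$. "Generic" means that all iterates exist, i.e. $w_n\in\mathbb{C}^*$ for all $n$. The numbers $s_j$ are defined by the power series $S(x)=\sum_{j\geqslant1}s_jx^j$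 with $1-S(x)=\dfrac{y+\mathcal{P}(x)}{\mathcal{Q}(x)}$, where $y=\sqrt{f(x)}\in\mathbb{C}[[x]]$ is the square root of $f$ with $y(0)=1$; equivalently $S$ is the formal expansion of the continued fraction $1-S(x)=1-\cfrac{w_1x}{1-\cfrac{w_2x}{1-\cfrac{w_3x}{1-\cdots}}}$. In particular $s_1,\dots,s_{g+1}$ are obtained from the coefficients of $x,\dots,x^{g+1}$ in $(\mathcal{Q}-\mathcal{P})S-\tfrac12\mathcal{Q}S^2+\mathcal{P}-\tfrac12\mathcal{Q}+\tfrac12\mathcal{R}=0$. *)

theory Defs
  imports
    "HOL-Computational_Algebra.Computational_Algebra"
    "Jordan_Normal_Form.Determinant"
begin

type_synonym triplet = "complex poly \<times> complex poly \<times> complex poly"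

definition M :: "nat \<Rightarrow> triplet set" where
  "M g = {(P, Q, R).
     degree P \<le> g \<and> poly.coeff P 0 = 1 \<and>
     degree Q \<le> g \<and> poly.coeff Q 0 = 2 \<and>
     degree R \<le> g + 1 \<and> poly.coeff R 0 = 0}"

fun mu :: "triplet \<Rightarrow> complex poly" where
  "mu (P, Q, R) = P\<^sup>2 + Q * R"

definition mu_fiber :: "nat \<Rightarrow> complex poly \<Rightarrow> triplet set" where
  "mu_fiber g f = {T \<in> M g. mu T = f}"

fun w_of :: "triplet \<Rightarrow> complex" where
  "w_of (P, Q, R) = - (2 * poly.coeff P 1 - poly.coeff Q 1 + poly.coeff R 1) / 2"

text \<open>On \<open>M g\<close> the Volterra map does not depend on \<open>g\<close>.  It is meaningful only where
  \<open>w_of\<close> does not vanish; the polynomial division is then exact (see \<open>volterra_division_exact\<close>).\<close>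

fun volterra :: "triplet \<Rightarrow> triplet" where
  "volterra (P, Q, R) =
     (Q - P,
      (2 * P - Q + R) div [:0, - w_of (P, Q, R):],
      [:0, - w_of (P, Q, R):] * Q)"

definition iterate :: "triplet \<Rightarrow> nat \<Rightarrow> triplet" where
  "iterate T n = (volterra ^^ n) T"

text \<open>Indexed from \<open>1\<close>: the term of index \<open>n + 1\<close> is the value of \<open>w_of\<close> at the \<open>n\<close>-th iterate.\<close>

definition w_seq :: "triplet \<Rightarrow> nat \<Rightarrow> complex" where
  "w_seq T n = w_of (iterate T (n - 1))"

definition generic :: "triplet \<Rightarrow> bool" where
  "generic T \<longleftrightarrow> (\<forall>n\<ge>1. w_seq T n \<noteq> 0)"

text \<open>The square root with constant term \<open>1\<close>; it exists and is unique when \<open>f(0) = 1\<close>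
  (see \<open>sqrt_series_unique\<close>).\<close>

definition sqrt_series :: "complex poly \<Rightarrow> complex fps" where
  "sqrt_series f = (THE y. y\<^sup>2 = fps_of_poly f \<and> fps_nth y 0 = 1)"

fun S_series :: "triplet \<Rightarrow> complex fps" where
  "S_series (P, Q, R) =
     1 - (sqrt_series (mu (P, Q, R)) + fps_of_poly P) / fps_of_poly Q"

text \<open>The left-hand side of the quadratic equation satisfied by \<open>S_series (P, Q, R)\<close>.\<close>

fun quadratic :: "triplet \<Rightarrow> complex fps \<Rightarrow> complex fps" where
  "quadratic (P, Q, R) S =
     fps_of_poly (Q - P) * S - fps_const (1/2) * fps_of_poly Q * S\<^sup>2
       + fps_of_poly P - fps_const (1/2) * fps_of_poly Q + fps_const (1/2) * fps_of_poly R"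

text \<open>\<open>Delta s (2 k - 1) = det (s\<^bsub>i+j-1\<^esub>)\<close> and \<open>Delta s (2 k) = det (s\<^bsub>i+j\<^esub>)\<close> for \<open>i, j = 1, \<dots>, k\<close>;
  matrix indices start at \<open>0\<close> in the library, whence the shift by \<open>2\<close>.\<close>

definition Delta :: "(nat \<Rightarrow> complex) \<Rightarrow> int \<Rightarrow> complex" where
  "Delta s m =
     (if m \<le> 0 then 1
      else if odd m then
        (let k = nat ((m + 1) div 2) in det (mat k k (\<lambda>(i, j). s (i + j + 1))))
      else
        (let k = nat (m div 2) in det (mat k k (\<lambda>(i, j). s (i + j + 2)))))"

lemma sqrt_series_unique:
  fixes f :: "complex poly"
  assumes "poly.coeff f 0 = 1"
  shows "\<exists>!y. y\<^sup>2 = fps_of_poly f \<and> fps_nth y 0 = 1"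
proof -
  have f0: "fps_nth (fps_of_poly f) 0 = 1" using assms by simp
  define y where "y = fps_radical (\<lambda>_ _. 1) (Suc 1) (fps_of_poly f)"
  have y0: "fps_nth y 0 = 1" by (simp add: y_def)
  have "y ^ Suc 1 = fps_of_poly f"
    unfolding y_def using power_radical[of "fps_of_poly f" "\<lambda>_ _. 1" 1] f0
    by (simp del: power_Suc)
  then have y2: "y * y = fps_of_poly f" by simp
  show ?thesis
  proof (rule ex1I[of _ y])
    show "y\<^sup>2 = fps_of_poly f \<and> fps_nth y 0 = 1"
      using y0 y2 by (simp only: power2_eq_square)
    fix z
    assume z: "z\<^sup>2 = fps_of_poly f \<and> fps_nth z 0 = 1"
    then have "z * z = y * y" by (simp only: power2_eq_square y2)
    then have "z = y \<or> z = - y" by (simp only: square_eq_iff)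
    moreover have "z \<noteq> - y"
    proof
      assume "z = - y"
      then have "fps_nth z 0 = - fps_nth y 0" by (simp only: fps_neg_nth)
      then show False using z y0 by simp
    qed
    ultimately show "z = y" by blast
  qed
qed

lemma volterra_division_exact:
  assumes "(P, Q, R) \<in> M g" "w_of (P, Q, R) \<noteq> 0"
  shows "[:0, - w_of (P, Q, R):] dvd 2 * P - Q + R"
proof -
  have "poly (2 * P - Q + R) 0 = 0"
    using assms(1) by (simp add: M_def flip: poly_0_coeff_0 del: w_of.simps)
  then have "[:0, 1:] dvd 2 * P - Q + R"
    using poly_eq_0_iff_dvd[of "2 * P - Q + R" 0] by simp
  moreover have "[:0, - w_of (P, Q, R):] = Polynomial.smult (- w_of (P, Q, R)) [:0, 1:]"
    by (simp del: w_of.simps)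
  ultimately show ?thesis
    using assms(2) by (simp only: smult_dvd_iff) simp
qed

end

theory Submission
  imports Defs
begin

text \<open>Writing \<open>S\<^sub>n\<close> for the series of the \<open>n\<close>-th iterate, one has \<open>S\<^sub>n (1 - S\<^sub>n\<^sub>+\<^sub>1) = w\<^sub>n\<^sub>+\<^sub>1 x\<close>. For
  \<open>U = 1 / (1 - x B)\<close> the identities \<open>U(x) - U(y) = U(x) U(y) (x B(x) - y B(y))\<close> and
  \<open>x U(x) - y U(y) = U(x) U(y) (x - y + x y (B(x) - B(y)))\<close>, divided by \<open>x - y\<close>, say that a
  Hankel matrix of \<open>U\<close> is congruent, by a lower unitriangular Toeplitz matrix, to a Hankel matrix
  of \<open>B\<close>, bordered by a \<open>1\<close> in the second case. Hence \<open>\<Delta>\<^sub>m(S\<^sub>n)\<close> is a power of \<open>w\<^sub>n\<^sub>+\<^sub>1\<close> times \<open>\<Delta>\<^sub>m\<^sub>-\<^sub>1(S\<^sub>n\<^sub>+\<^sub>1)\<close>, and the formula for \<open>w\<^sub>n\<close>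
  follows by induction on \<open>n\<close>.\<close>

section \<open>Hankel determinants\<close>

definition hankel :: "nat \<Rightarrow> (nat \<Rightarrow> 'a) \<Rightarrow> 'a :: idom mat" where
  "hankel n a = mat n n (\<lambda>(i, j). a (i + j))"

text \<open>The matrix, modulo x^n, of multiplication by the power series with coefficients
  \<open>u\<close>.\<close>

definition toeplitz :: "nat \<Rightarrow> (nat \<Rightarrow> 'a) \<Rightarrow> 'a :: idom mat" where
  "toeplitz n u = mat n n (\<lambda>(i, j). if j \<le> i then u (i - j) else 0)"

lemma hankel_carrier [simp]: "hankel n a \<in> carrier_mat n n"
  by (simp add: hankel_def)

lemma toeplitz_carrier [simp]: "toeplitz n u \<in> carrier_mat n n"
  by (simp add: toeplitz_def)

lemma toeplitz_index:
  "i < n \<Longrightarrow> j < n \<Longrightarrow> toeplitz n u $$ (i, j) = (if j \<le> i then u (i - j) else 0)"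
  by (simp add: toeplitz_def)

lemma det_toeplitz:
  assumes "u 0 = 1"
  shows "det (toeplitz n u) = 1"
proof -
  have "det (toeplitz n u) = prod_list (diag_mat (toeplitz n u))"
    by (rule det_lower_triangular[of n]) (auto simp: toeplitz_def)
  also have "diag_mat (toeplitz n u) = replicate n 1"
    using assms by (intro nth_equalityI) (auto simp: diag_mat_def toeplitz_def)
  finally show ?thesis by simp
qed

text \<open>In generating functions, the congruence multiplies the polynomial in x and y with
  coefficients \<open>B (k, l)\<close> by U(x) U(y). Rows of the Toeplitz matrix end at the
  diagonal, so the sums stop at i and j instead of running up to n.\<close>

lemma toeplitz_congruence_index:
  fixes u :: "nat \<Rightarrow> 'a :: idom"
  assumes "i < n" "j < n"
  shows "(toeplitz n u * mat n n B * transpose_mat (toeplitz n u)) $$ (i, j) =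
    (\<Sum>k\<le>i. \<Sum>l\<le>j. u (i - k) * B (k, l) * u (j - l))"
proof -
  have trunc: "(\<Sum>k<n. (if k \<le> i then h k else 0)) = sum h {..i}"
    if "i < n" for h :: "nat \<Rightarrow> 'a" and i
  proof -
    have "{..<n} \<inter> {k. k \<le> i} = {..i}" using that by auto
    then show ?thesis by (simp flip: sum.inter_restrict add: sum.If_cases)
  qed
  have "(toeplitz n u * mat n n B) $$ (i, l) = (\<Sum>k\<le>i. u (i - k) * B (k, l))" if "l < n" for l
  proof -
    have "(toeplitz n u * mat n n B) $$ (i, l)
      = (\<Sum>k<n. (if k \<le> i then u (i - k) * B (k, l) else 0))"
      using assms that
      by (auto simp: toeplitz_def scalar_prod_def atLeast0LessThan intro!: sum.cong)
    then show ?thesis using trunc[OF assms(1)] by simp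
  qed
  note left = this
  have "(toeplitz n u * mat n n B * transpose_mat (toeplitz n u)) $$ (i, j)
    = (\<Sum>l<n. (toeplitz n u * mat n n B) $$ (i, l) * toeplitz n u $$ (j, l))"
    using assms
    by (auto simp: scalar_prod_def atLeast0LessThan toeplitz_def intro!: sum.cong)
  also have "\<dots> = (\<Sum>l<n. (if l \<le> j then (\<Sum>k\<le>i. u (i - k) * B (k, l)) * u (j - l) else 0))"
    using assms by (intro sum.cong) (auto simp: left toeplitz_index simp del: index_mult_mat)
  also have "\<dots> = (\<Sum>l\<le>j. (\<Sum>k\<le>i. u (i - k) * B (k, l)) * u (j - l))"
    using trunc[OF assms(2)] by simp
  also have "\<dots> = (\<Sum>k\<le>i. \<Sum>l\<le>j. u (i - k) * B (k, l) * u (j - l))"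
    by (subst sum.swap) (simp add: sum_distrib_right)
  finally show ?thesis .
qed

text \<open>Both outer factors of the congruence have determinant 1. The hypothesis is entrywise so
  that coefficient identities can be inserted directly.\<close>

lemma det_toeplitz_congruence:
  fixes u :: "nat \<Rightarrow> 'a :: idom"
  assumes "u 0 = 1"
    and "\<And>i j. i < n \<Longrightarrow> j < n \<Longrightarrow> A (i, j) = (\<Sum>k\<le>i. \<Sum>l\<le>j. u (i - k) * B (k, l) * u (j - l))"
  shows "det (mat n n A) = det (mat n n B)"
proof -
  have "mat n n A = toeplitz n u * mat n n B * transpose_mat (toeplitz n u)"
    by (rule eq_matI) (simp_all add: assms(2) toeplitz_congruence_index carrier_matD[OF toeplitz_carrier]
        del: index_mult_mat(1))
  then show ?thesis
    using det_toeplitz[of u n, OF assms(1)]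
    by (simp add: det_mult[of _ n] det_transpose[of _ n] mult_carrier_mat[of _ n n])
qed

text \<open>The recursion says U = 1 + x U B for the generating functions of \<open>u\<close> and
  \<open>b\<close>. The two-variable identities are obtained without bivariate series: peeling off k
  = 0 or l = 0 gives \<open>F (Suc i) j = F i (Suc j)\<close>, so \<open>F\<close> depends only on i
  + j and can be read off at j = 0.\<close>

lemma hankel_convolution_sum:
  fixes u b :: "nat \<Rightarrow> 'a :: idom"
  assumes "u 0 = 1" and rec: "\<And>n. u (Suc n) = (\<Sum>i\<le>n. u (n - i) * b i)"
  shows "u (Suc (i + j)) = (\<Sum>k\<le>i. \<Sum>l\<le>j. u (i - k) * b (k + l) * u (j - l))"
    and "u (Suc (Suc (i + j))) = u (Suc i) * u (Suc j)
      + (\<Sum>k\<le>i. \<Sum>l\<le>j. u (i - k) * b (Suc (k + l)) * u (j - l))"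
proof -
  define F where "F i j = (\<Sum>k\<le>i. \<Sum>l\<le>j. u (i - k) * b (k + l) * u (j - l))" for i j
  define G where "G i j = (\<Sum>k\<le>i. \<Sum>l\<le>j. u (i - k) * b (Suc (k + l)) * u (j - l))" for i j
  \<comment> \<open>The term k = 0 is \<open>u (Suc i)\<close> times the recursion sum for
    \<open>u (Suc j)\<close>; the terms k > 0 form \<open>G i j\<close>.\<close>
  have F_left: "F (Suc i) j = u (Suc i) * u (Suc j) + G i j" for i j
    unfolding F_def sum.atMost_Suc_shift
    by (simp add: rec[of j] G_def sum_distrib_left mult_ac)
  have F_right: "F i (Suc j) = u (Suc i) * u (Suc j) + G i j" for i j
    unfolding F_def sum.atMost_Suc_shift
    by (simp add: rec[of i] G_def sum_distrib_right sum.distrib)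
  have F: "F i j = u (Suc (i + j))" for i j
  proof (induction j arbitrary: i)
    case 0
    then show ?case by (simp add: F_def rec assms(1))
  next
    case (Suc j)
    then show ?case using F_left[of i j] F_right[of i j] by simp
  qed
  show "u (Suc (i + j)) = (\<Sum>k\<le>i. \<Sum>l\<le>j. u (i - k) * b (k + l) * u (j - l))"
    using F[of i j] by (simp add: F_def)
  show "u (Suc (Suc (i + j))) = u (Suc i) * u (Suc j)
      + (\<Sum>k\<le>i. \<Sum>l\<le>j. u (i - k) * b (Suc (k + l)) * u (j - l))"
    using F[of "Suc i" j] F_left[of i j] by (simp add: G_def)
qed

lemma det_hankel_shift:
  assumes "u 0 = 1" and "\<And>n. u (Suc n) = (\<Sum>i\<le>n. u (n - i) * b i)"
  shows "det (hankel n (\<lambda>m. u (Suc m))) = det (hankel n b)"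
  unfolding hankel_def
  by (rule det_toeplitz_congruence[of u]) (use assms hankel_convolution_sum[of u b] in auto)

lemma det_hankel_Suc:
  fixes u b :: "nat \<Rightarrow> 'a :: idom"
  assumes "u 0 = 1" and "\<And>n. u (Suc n) = (\<Sum>i\<le>n. u (n - i) * b i)"
  shows "det (hankel (Suc n) u) = det (hankel n (\<lambda>m. b (Suc m)))"
proof -
  \<comment> \<open>Coefficients of 1 + x y (b(x) - b(y)) / (x - y), where b(x) is the generating
    function of \<open>b\<close>: a corner 1 and a shifted Hankel block.\<close>
  define B :: "nat \<times> nat \<Rightarrow> 'a" where
    "B = (\<lambda>(k, l). case (k, l) of (0, 0) \<Rightarrow> 1 | (Suc k', Suc l') \<Rightarrow> b (Suc (k' + l')) | _ \<Rightarrow> 0)"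
  have B [simp]: "B (0, 0) = 1" "B (Suc k, 0) = 0" "B (0, Suc l) = 0"
    "B (Suc k, Suc l) = b (Suc (k + l))" for k l
    by (simp_all add: B_def)
  have "det (hankel (Suc n) u) = det (mat (Suc n) (Suc n) B)"
    unfolding hankel_def
  proof (rule det_toeplitz_congruence[of u])
    show "u 0 = 1" by fact
    show "(case (i, j) of (i, j) \<Rightarrow> u (i + j)) =
      (\<Sum>k\<le>i. \<Sum>l\<le>j. u (i - k) * B (k, l) * u (j - l))" for i j
    \<comment> \<open>In row or column 0 only the corner of \<open>B\<close> contributes. Elsewhere
      the corner gives \<open>u i * u j\<close> and the block gives the double sum.\<close>
    proof (cases i; cases j)
      fix i' j' assume "i = Suc i'" "j = Suc j'"
      then show ?thesis
        using hankel_convolution_sum(2)[of u b i' j', OF assms]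
        by (simp add: sum.atMost_Suc_shift del: sum.atMost_Suc)
    qed (simp_all add: assms(1) sum.atMost_Suc_shift del: sum.atMost_Suc)
  qed
  also have "mat (Suc n) (Suc n) B =
    four_block_mat (1\<^sub>m 1) (0\<^sub>m 1 n) (0\<^sub>m n 1) (hankel n (\<lambda>m. b (Suc m)))"
    by (rule eq_matI) (auto simp: hankel_def less_Suc_eq_0_disj)
  also have "det \<dots> = det (1\<^sub>m 1 :: 'a mat) * det (hankel n (\<lambda>m. b (Suc m)))"
    by (rule det_four_block_mat_lower_left_zero[of _ 1 _ n]) auto
  finally show ?thesis by simp
qed

lemma det_hankel_scale: "det (hankel n (\<lambda>m. c * a m)) = c ^ n * det (hankel n a)"
proof -
  have "hankel n (\<lambda>m. c * a m) = c \<cdot>\<^sub>m hankel n a"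
    by (rule eq_matI) (auto simp: hankel_def)
  then show ?thesis by (simp add: hankel_def)
qed

section \<open>The determinants \<open>Delta\<close> along a continued fraction\<close>

lemma Delta_nonpos: "m \<le> 0 \<Longrightarrow> Delta s m = 1"
  by (simp add: Delta_def)

lemma Delta_odd: "Delta s (2 * int k + 1) = det (hankel (Suc k) (\<lambda>m. s (Suc m)))"
proof -
  have "nat (1 + int k) = Suc k" by simp
  then show ?thesis by (simp add: Delta_def hankel_def Let_def)
qed

lemma Delta_even: "Delta s (2 * int k) = det (hankel k (\<lambda>m. s (Suc (Suc m))))"
  \<comment> \<open>At k = 0 the default value 1 of \<open>Delta\<close> agrees with the empty
    determinant.\<close>
  by (cases "k = 0") (simp_all add: Delta_def hankel_def Let_def)

text \<open>Here S = w x U with U = 1 / (1 - S'), so each matrix entry on the left carries a factor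
  w. The exponent is the matrix size, which is 0 for nonpositive m. Odd m uses the bordered
  congruence, even m the unbordered one.\<close>

lemma Delta_step:
  fixes S S' :: "complex fps"
  assumes "fps_nth S 0 = 0" and "fps_nth S' 0 = 0" and "w \<noteq> 0"
    and eq: "S * (1 - S') = fps_const w * fps_X"
  shows "Delta (fps_nth S) m = w ^ nat ((m + 1) div 2) * Delta (fps_nth S') (m - 1)"
proof -
  define u where "u n = fps_nth S (Suc n) / w" for n
  define b where "b n = fps_nth S' (Suc n)" for n
  have S: "fps_nth S (Suc n) = w * u n" for n
    using assms(3) by (simp add: u_def)
  have conv: "fps_nth (S * (1 - S')) (Suc n)
      = fps_nth S (Suc n) - (\<Sum>i=0..Suc n. fps_nth S i * fps_nth S' (Suc n - i))" for n
    by (simp add: algebra_simps fps_mult_nth)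
  have "fps_nth S 1 = w"
    using conv[of 0] assms(1,2) by (simp add: eq)
  then have u0: "u 0 = 1" using assms(3) by (simp add: u_def)
  have rec: "u (Suc n) = (\<Sum>i\<le>n. u (n - i) * b i)" for n
  proof -
    have "fps_nth S (Suc (Suc n))
        = (\<Sum>i=0..Suc (Suc n). fps_nth S i * fps_nth S' (Suc (Suc n) - i))"
      using conv[of "Suc n"] by (simp add: eq)
    \<comment> \<open>Both end terms of the convolution drop out, because S and S' have zero
      constant term.\<close>
    also have "\<dots> = (\<Sum>i\<le>n. fps_nth S (Suc i) * fps_nth S' (Suc (n - i)))"
      unfolding atLeast0AtMost
      by (subst sum.atMost_Suc, subst sum.atMost_Suc_shift) (simp add: assms(1,2) Suc_diff_le)
    also have "\<dots> = w * (\<Sum>i\<le>n. u i * b (n - i))"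
      by (simp add: S b_def sum_distrib_left mult_ac)
    also have "(\<Sum>i\<le>n. u i * b (n - i)) = (\<Sum>i\<le>n. u (n - i) * b i)"
      by (rule sum.reindex_bij_witness[of _ "\<lambda>i. n - i" "\<lambda>i. n - i"]) auto
    finally show ?thesis using assms(3) by (simp add: S)
  qed
  consider (nonpos) "m \<le> 0" | (odd) k where "m = 2 * int k + 1"
    | (even) k where "m = 2 * int (Suc k)"
  proof -
    have "m \<le> 0 \<or> (\<exists>k. m = 2 * int k + 1) \<or> (\<exists>k. m = 2 * int (Suc k))"
    proof (cases "m \<le> 0")
      case False
      then obtain n where "m = int (Suc n)"
        by (metis gr0_conv_Suc not_le zero_less_imp_eq_int)
      then show ?thesis by (cases "even n") (auto elim!: evenE oddE)
    qed simp
    then show ?thesis using that by blast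
  qed
  then show ?thesis
  proof cases
    case nonpos
    then show ?thesis by (simp add: Delta_nonpos)
  next
    case odd
    have "nat ((m + 1) div 2) = Suc k" using odd by simp
    then show ?thesis
      using det_hankel_Suc[of u b k, OF u0 rec] odd
      by (simp add: Delta_odd Delta_even S det_hankel_scale b_def)
  next
    case even
    have "nat ((m + 1) div 2) = Suc k" "m - 1 = 2 * int k + 1" using even by simp_all
    moreover from this have "Delta (fps_nth S') (m - 1) = det (hankel (Suc k) b)"
      by (simp only: Delta_odd b_def[abs_def])
    moreover have "Delta (fps_nth S) m = w ^ Suc k * det (hankel (Suc k) (\<lambda>n. u (Suc n)))"
      unfolding even Delta_even S det_hankel_scale ..
    ultimately show ?thesis
      using det_hankel_shift[of u b "Suc k", OF u0 rec] by simp
  qed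
qed

text \<open>Passing from \<open>S n\<close> to \<open>S (Suc n)\<close> lowers the index of
  \<open>Delta\<close> by one at the cost of a power of \<open>w n\<close>, which is nonzero. Both
  claims follow by induction on the index with n arbitrary.\<close>

lemma continued_fraction_Delta:
  fixes S :: "nat \<Rightarrow> complex fps" and w :: "nat \<Rightarrow> complex"
  assumes "\<And>n. fps_nth (S n) 0 = 0" and "\<And>n. w n \<noteq> 0"
    and "\<And>n. S n * (1 - S (Suc n)) = fps_const (w n) * fps_X"
  shows "Delta (fps_nth (S n)) m \<noteq> 0"
    and "Delta (fps_nth (S n)) (int k - 2) * Delta (fps_nth (S n)) (int k + 1)
      = w (n + k) * (Delta (fps_nth (S n)) (int k - 1) * Delta (fps_nth (S n)) (int k))"
proof -
  note step = Delta_step[OF assms(1) assms(1) assms(2) assms(3)]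
  have "Delta (fps_nth (S n)) (int k) \<noteq> 0" for k
  proof (induction k arbitrary: n)
    case 0
    then show ?case by (simp add: Delta_nonpos)
  next
    case (Suc k)
    have "Delta (fps_nth (S n)) (int (Suc k))
        = w n ^ nat ((int (Suc k) + 1) div 2) * Delta (fps_nth (S (Suc n))) (int k)"
      using step[of n "int (Suc k)"] by simp
    then show ?case using Suc.IH[of "Suc n"] assms(2)[of n] by simp
  qed
  then show "Delta (fps_nth (S n)) m \<noteq> 0"
    by (metis Delta_nonpos int_nat_eq linorder_le_cases nat_0_le one_neq_zero)
  show "Delta (fps_nth (S n)) (int k - 2) * Delta (fps_nth (S n)) (int k + 1)
      = w (n + k) * (Delta (fps_nth (S n)) (int k - 1) * Delta (fps_nth (S n)) (int k))"
  proof (induction k arbitrary: n)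
    case 0
    then show ?case using step[of n 1] by (simp add: Delta_nonpos)
  next
    case (Suc k)
    define e where "e m = w n ^ nat ((m + 1) div 2)" for m :: int
    define D where "D = Delta (fps_nth (S (Suc n)))"
    have D: "Delta (fps_nth (S n)) m = e m * D (m - 1)" for m
      unfolding e_def D_def by (rule step)
    \<comment> \<open>Both sides equal k + 1. They are the exponents of \<open>w n\<close> on the
      two sides of the claim, so these powers cancel.\<close>
    have "int k div 2 + (int k + 3) div 2 = (int k + 1) div 2 + (int k + 2) div 2"
      by presburger
    then have "nat (int k div 2) + nat ((int k + 3) div 2)
        = nat ((int k + 1) div 2) + nat ((int k + 2) div 2)"
      by (simp flip: nat_add_distrib)
    then have e: "e (int k - 1) * e (int k + 2) = e (int k) * e (int k + 1)"
      by (simp add: e_def algebra_simps flip: power_add)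
    have IH: "D (int k - 2) * D (int k + 1) = w (n + Suc k) * (D (int k - 1) * D (int k))"
      using Suc.IH[of "Suc n"] by (simp add: D_def)
    have "Delta (fps_nth (S n)) (int (Suc k) - 2) * Delta (fps_nth (S n)) (int (Suc k) + 1)
      = (e (int k - 1) * e (int k + 2)) * (D (int k - 2) * D (int k + 1))"
      unfolding D by (simp add: algebra_simps)
    also have "\<dots> = w (n + Suc k) * ((e (int k) * D (int k - 1)) * (e (int k + 1) * D (int k)))"
      unfolding e IH by (simp add: mult_ac)
    finally show ?case unfolding D by (simp add: algebra_simps)
  qed
qed

section \<open>The series attached to a triplet\<close>

lemma sqrt_series_props:
  assumes "poly.coeff f 0 = 1"
  shows "(sqrt_series f)\<^sup>2 = fps_of_poly f" "fps_nth (sqrt_series f) 0 = 1"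
  using theI'[OF sqrt_series_unique[OF assms]] by (simp_all add: sqrt_series_def)

lemma mu_coeff_0: "T \<in> M g \<Longrightarrow> poly.coeff (mu T) 0 = 1"
  by (cases T) (auto simp: M_def coeff_mult power2_eq_square)

text \<open>Q(0) = 2 makes Q a unit among power series, so the defining quotient can be multiplied
  out.\<close>

lemma S_series_eq:
  assumes "(P, Q, R) \<in> M g"
  shows "(1 - S_series (P, Q, R)) * fps_of_poly Q = sqrt_series (mu (P, Q, R)) + fps_of_poly P"
  using assms by (simp add: M_def fps_divide_unit mult.assoc inverse_mult_eq_1)

lemma fps_of_poly_neq_0_M:
  assumes "(P, Q, R) \<in> M g"
  shows "fps_of_poly Q \<noteq> 0"
  using assms by (auto simp: M_def)

text \<open>Since y(0) = P(0) = 1 and Q(0) = 2, the quotient (y + P) / Q starts with 1; this is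
  where the branch of the square root enters.\<close>

lemma S_series_0:
  assumes "T \<in> M g"
  shows "fps_nth (S_series T) 0 = 0"
proof -
  obtain P Q R where T: "T = (P, Q, R)" by (cases T)
  have "fps_nth ((1 - S_series T) * fps_of_poly Q) 0 = 2"
    using S_series_eq[of P Q R g] assms sqrt_series_props(2)[OF mu_coeff_0[OF assms]]
    by (simp add: T M_def del: S_series.simps mu.simps)
  then show ?thesis using assms by (simp add: T M_def del: S_series.simps)
qed

lemma quadratic_S_series:
  assumes "T \<in> M g"
  shows "quadratic T (S_series T) = 0"
proof -
  obtain P Q R where T: "T = (P, Q, R)" by (cases T)
  define y where "y = sqrt_series (mu T)"
  define S where "S = S_series T"
  let ?p = "fps_of_poly P" and ?q = "fps_of_poly Q" and ?r = "fps_of_poly R"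
  \<comment> \<open>The constant 1/2 is made opaque, so that the ring identity below treats it as a
    variable subject only to \<open>h * 2 = 1\<close>.\<close>
  obtain h where h_eq: "fps_const (1/2 :: complex) = h" by blast
  have y: "y = (1 - S) * ?q - ?p"
    using S_series_eq[of P Q R g] assms by (simp add: y_def S_def T del: S_series.simps mu.simps)
  have y2: "y\<^sup>2 = ?p\<^sup>2 + ?q * ?r"
    using sqrt_series_props(1)[OF mu_coeff_0[OF assms]]
    by (simp add: y_def T fps_of_poly_add fps_of_poly_mult fps_of_poly_power)
  have h: "h * 2 = 1"
    by (simp add: fps_numeral_fps_const flip: h_eq)
  have "?q * quadratic T S = h * (?p\<^sup>2 + ?q * ?r - y\<^sup>2)"
  proof -
    have "h * (?p\<^sup>2 + ?q * ?r - y\<^sup>2)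
        = ?q * quadratic T S + (h * 2 - 1) * (?q * (?q * S + ?p - ?p * S))"
      unfolding T y quadratic.simps fps_of_poly_diff h_eq
      by (simp add: algebra_simps power2_eq_square)
    then show ?thesis by (simp add: h)
  qed
  then have "?q * quadratic T S = 0" by (simp add: y2)
  then show ?thesis using fps_of_poly_neq_0_M[of P Q R g] assms by (simp add: T S_def)
qed

text \<open>Both triplets share the same square root y, because \<open>mu\<close> is preserved. With
  tildes for the image, S Q = (Q - P) - y and (1 - S~) Q~ = (Q - P) + y multiply to (Q - P)^2 - y^2
  = w x Q Q~, and Q Q~ cancels.\<close>

lemma volterra_M:
  assumes "T \<in> M g" "w_of T \<noteq> 0"
  shows "volterra T \<in> M g" and "mu (volterra T) = mu T"
    and "S_series T * (1 - S_series (volterra T)) = fps_const (w_of T) * fps_X"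
proof -
  obtain P Q R where T: "T = (P, Q, R)" by (cases T)
  define w where "w = w_of T"
  define Q' where "Q' = (2 * P - Q + R) div [:0, - w:]"
  have w0: "w \<noteq> 0" using assms by (simp add: w_def)
  have V: "volterra T = (Q - P, Q', [:0, - w:] * Q)"
    by (simp add: T w_def Q'_def)
  have Q': "[:0, - w:] * Q' = 2 * P - Q + R"
    using dvd_mult_div_cancel[OF volterra_division_exact[of P Q R g]] assms
    unfolding Q'_def w_def T by blast
  \<comment> \<open>Division by -w x shifts indices by one, so the degree bound g + 1 of the
    numerator becomes g for \<open>Q'\<close>.\<close>
  have coeff: "- w * poly.coeff Q' n = poly.coeff (2 * P - Q + R) (Suc n)" for n
    by (simp flip: Q')
  have c1: "2 * P = Polynomial.smult 2 P"
    by (simp add: numeral_poly)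
  have "poly.coeff Q' n = 0" if "n > g" for n
    using coeff[of n] that assms(1) w0 by (auto simp: c1 M_def T coeff_eq_0)
  then have degQ': "degree Q' \<le> g"
    by (meson degree_le)
  \<comment> \<open>The normalisation of w enters here: the coefficient of x in 2 P - Q + R is -2
    w.\<close>
  have "- w * poly.coeff Q' 0 = - w * 2"
    unfolding coeff by (simp add: c1 w_def T diff_divide_distrib add_divide_distrib)
  then have "poly.coeff Q' 0 = 2" using w0 by simp
  then show VM: "volterra T \<in> M g"
    unfolding V using assms(1) degQ' w0 unfolding T M_def
    by (auto intro: degree_diff_le)
  have "mu (volterra T) = (Q - P)\<^sup>2 + ([:0, - w:] * Q') * Q"
    unfolding V by (simp add: mult_ac)
  also have "\<dots> = mu T" unfolding Q' T mu.simps by (simp add: algebra_simps power2_eq_square)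
  finally show mu: "mu (volterra T) = mu T" .
  define y where "y = sqrt_series (mu T)"
  have S: "(1 - S_series T) * fps_of_poly Q = y + fps_of_poly P"
    using S_series_eq[of P Q R g] assms(1) by (simp add: y_def T del: S_series.simps mu.simps)
  have S': "(1 - S_series (volterra T)) * fps_of_poly Q' = y + fps_of_poly (Q - P)"
    using S_series_eq[of "Q - P" Q' "[:0, - w:] * Q" g] VM mu
    by (simp only: y_def V)
  \<comment> \<open>Expanding \<open>mu\<close> at the image rather than at T brings in the factor w
    x Q Q'.\<close>
  have "y\<^sup>2 = fps_of_poly (mu (volterra T))"
    using sqrt_series_props(1)[OF mu_coeff_0[OF assms(1)]] by (simp add: y_def mu)
  also have "\<dots> = (fps_of_poly (Q - P))\<^sup>2 + fps_of_poly Q' * (fps_of_poly [:0, - w:] * fps_of_poly Q)"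
    unfolding V mu.simps by (simp only: fps_of_poly_add fps_of_poly_mult fps_of_poly_power)
  also have "fps_of_poly [:0, - w:] = - (fps_const w * fps_X)"
    by (simp add: fps_of_poly_pCons mult.commute)
  finally have y2: "y\<^sup>2 = (fps_of_poly (Q - P))\<^sup>2 - fps_const w * fps_X * fps_of_poly Q' * fps_of_poly Q"
    by (simp add: mult_ac)
  have SQ: "S_series T * fps_of_poly Q = fps_of_poly (Q - P) - y"
    using S by (simp add: fps_of_poly_diff algebra_simps del: S_series.simps)
  have "(S_series T * fps_of_poly Q) * ((1 - S_series (volterra T)) * fps_of_poly Q')
      = (fps_of_poly (Q - P))\<^sup>2 - y\<^sup>2"
    unfolding SQ S' by (simp add: algebra_simps power2_eq_square del: S_series.simps)
  then have "(S_series T * (1 - S_series (volterra T))) * (fps_of_poly Q * fps_of_poly Q')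
      = (fps_const w * fps_X) * (fps_of_poly Q * fps_of_poly Q')"
    unfolding y2 by (simp add: mult_ac del: S_series.simps)
  moreover have "fps_of_poly Q \<noteq> 0" "fps_of_poly Q' \<noteq> 0"
    using fps_of_poly_neq_0_M assms(1)[unfolded T] VM[unfolded V] by blast+
  ultimately show "S_series T * (1 - S_series (volterra T)) = fps_const (w_of T) * fps_X"
    unfolding w_def by (metis mult_right_cancel mult_eq_0_iff)
qed

section \<open>Iterates of the Volterra map\<close>

lemma w_of_iterate: "w_of (iterate T n) = w_seq T (Suc n)"
  by (simp add: w_seq_def)

lemma iterate_M:
  assumes "T \<in> M g" "generic T"
  shows "iterate T n \<in> M g"
proof (induction n)
  case 0
  then show ?case using assms by (simp add: iterate_def)
next
  case (Suc n)
  have "w_of (iterate T n) \<noteq> 0"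
    using assms(2) by (simp add: w_of_iterate generic_def)
  from volterra_M(1)[OF Suc this] show ?case by (simp add: iterate_def)
qed

lemma w_seq_Delta:
  assumes "T \<in> M g" "generic T"
  shows "Delta (fps_nth (S_series T)) m \<noteq> 0"
    and "Delta (fps_nth (S_series T)) (int k - 2) * Delta (fps_nth (S_series T)) (int k + 1)
      = w_seq T (Suc k)
        * (Delta (fps_nth (S_series T)) (int k - 1) * Delta (fps_nth (S_series T)) (int k))"
proof -
  define S where "S n = S_series (iterate T n)" for n
  \<comment> \<open>The continued fraction lemma counts from 0, whereas \<open>w_seq\<close> starts
    at 1.\<close>
  define w where "w n = w_seq T (Suc n)" for n
  have w: "w n \<noteq> 0" for n using assms(2) by (simp add: w_def generic_def)
  have S0: "fps_nth (S n) 0 = 0" for n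
    unfolding S_def by (rule S_series_0[OF iterate_M[OF assms]])
  have eq: "S n * (1 - S (Suc n)) = fps_const (w n) * fps_X" for n
    using volterra_M(3)[OF iterate_M[OF assms], of n] w[of n]
    by (simp add: S_def w_def w_of_iterate[unfolded iterate_def] iterate_def)
  have S: "S_series T = S 0" by (simp add: S_def iterate_def)
  show "Delta (fps_nth (S_series T)) m \<noteq> 0"
    unfolding S by (rule continued_fraction_Delta(1)[of S w, OF S0 w eq])
  show "Delta (fps_nth (S_series T)) (int k - 2) * Delta (fps_nth (S_series T)) (int k + 1)
      = w_seq T (Suc k)
        * (Delta (fps_nth (S_series T)) (int k - 1) * Delta (fps_nth (S_series T)) (int k))"
    using continued_fraction_Delta(2)[of S w 0 k, OF S0 w eq] by (simp add: S w_def)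
qed

section \<open>Coefficients of the quadratic equation\<close>

lemma fps_of_poly_mult_nth:
  fixes p :: "'a :: comm_ring_1 poly"
  assumes "degree p \<le> g" "g \<le> j"
  shows "fps_nth (fps_of_poly p * F) j
    = poly.coeff p 0 * fps_nth F j + (\<Sum>k=1..g. poly.coeff p k * fps_nth F (j - k))"
proof -
  have "fps_nth (fps_of_poly p * F) j = (\<Sum>k=0..j. poly.coeff p k * fps_nth F (j - k))"
    by (simp add: fps_mult_nth)
  also have "\<dots> = (\<Sum>k=0..g. poly.coeff p k * fps_nth F (j - k))"
    using assms by (intro sum.mono_neutral_right) (auto simp: coeff_eq_0)
  finally show ?thesis by (simp add: sum.atLeast_Suc_atMost)
qed

text \<open>The end terms i = 0 and i = j contain the factor \<open>fps_nth F 0\<close>. At j = 0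
  the truncated bound leaves an empty sum, as it should.\<close>

lemma fps_square_nth:
  fixes F :: "'a :: comm_ring_1 fps"
  assumes "fps_nth F 0 = 0"
  shows "fps_nth (F\<^sup>2) j = (\<Sum>i=1..j-1. fps_nth F i * fps_nth F (j - i))"
proof -
  have "fps_nth (F\<^sup>2) j = (\<Sum>i=0..j. fps_nth F i * fps_nth F (j - i))"
    by (simp add: power2_eq_square fps_mult_nth)
  also have "\<dots> = (\<Sum>i=1..j-1. fps_nth F i * fps_nth F (j - i))"
  proof (rule sum.mono_neutral_right)
    show "\<forall>i\<in>{0..j} - {1..j - 1}. fps_nth F i * fps_nth F (j - i) = 0"
    proof
      fix i assume "i \<in> {0..j} - {1..j - 1}"
      then have "i = 0 \<or> i = j" by auto
      then show "fps_nth F i * fps_nth F (j - i) = 0" using assms by auto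
    qed
  qed auto
  finally show ?thesis .
qed

text \<open>Beyond degree g + 1 the pure polynomial terms vanish. Since Q - P has constant term 1
  and Q/2 has constant term 1, the coefficient equation can be solved for
  \<open>fps_nth S j\<close>.\<close>

lemma quadratic_recursion:
  assumes M: "(P, Q, R) \<in> M g" and S0: "fps_nth S 0 = 0"
    and quad: "quadratic (P, Q, R) S = 0" and j: "j \<ge> g + 2"
  shows "fps_nth S j = (\<Sum>k=1..g. (poly.coeff P k - poly.coeff Q k) * fps_nth S (j - k))
      + (\<Sum>i=1..j - 1. fps_nth S i * fps_nth S (j - i))
      + 1/2 * (\<Sum>k=1..g. poly.coeff Q k * (\<Sum>i=1..j - k - 1. fps_nth S i * fps_nth S (j - k - i)))"
proof -
  have deg: "degree (Q - P) \<le> g" "degree Q \<le> g" and c: "poly.coeff P 0 = 1" "poly.coeff Q 0 = 2"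
    using M by (auto simp: M_def intro: degree_diff_le)
  have z: "poly.coeff P j = 0" "poly.coeff Q j = 0" "poly.coeff R j = 0"
    using M j by (auto simp: M_def intro!: coeff_eq_0)
  have "0 = fps_nth (quadratic (P, Q, R) S) j" by (simp only: quad fps_zero_nth)
  also have "\<dots> = fps_nth (fps_of_poly (Q - P) * S) j - 1/2 * fps_nth (fps_of_poly Q * S\<^sup>2) j"
    by (simp add: z mult.assoc)
  also have "fps_nth (fps_of_poly (Q - P) * S) j
      = fps_nth S j - (\<Sum>k=1..g. (poly.coeff P k - poly.coeff Q k) * fps_nth S (j - k))"
    using j by (subst fps_of_poly_mult_nth[OF deg(1)])
      (simp_all add: c left_diff_distrib sum_subtractf)
  also have "fps_nth (fps_of_poly Q * S\<^sup>2) j = 2 * (\<Sum>i=1..j - 1. fps_nth S i * fps_nth S (j - i))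
      + (\<Sum>k=1..g. poly.coeff Q k * (\<Sum>i=1..j - k - 1. fps_nth S i * fps_nth S (j - k - i)))"
    using j by (subst fps_of_poly_mult_nth[OF deg(2)]) (simp_all add: c fps_square_nth[OF S0])
  finally show ?thesis by (simp add: algebra_simps)
qed

text \<open>Coefficients of a product up to n involve only coefficients up to n of each factor, so
  vanishing passes to multiples; the converse multiplies by the inverse of E.\<close>

lemma fps_mult_unit_nth_zero_iff:
  fixes F E :: "'a :: field fps"
  assumes "fps_nth E 0 \<noteq> 0"
  shows "(\<forall>j\<le>n. fps_nth (F * E) j = 0) \<longleftrightarrow> (\<forall>j\<le>n. fps_nth F j = 0)"
proof -
  have vanish: "\<forall>j\<le>n. fps_nth (A * B) j = 0" if "\<forall>j\<le>n. fps_nth A j = 0" for A B :: "'a fps"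
    using that by (simp add: fps_mult_nth)
  have "F * E * inverse E = F"
    using assms by (simp add: mult.assoc inverse_mult_eq_1')
  then show ?thesis using vanish[of F E] vanish[of "F * E" "inverse E"] by metis
qed

text \<open>The difference of the quadratic expressions at S and T factors as (S - T) E, and E has
  constant term 1, hence is a unit.\<close>

lemma quadratic_determines_initial:
  assumes M: "(P, Q, R) \<in> M g" and S: "fps_nth S 0 = 0" and T: "fps_nth T 0 = 0"
    and quad: "quadratic (P, Q, R) T = 0"
  shows "(\<forall>j\<in>{1..n}. fps_nth (quadratic (P, Q, R) S) j = 0)
    \<longleftrightarrow> (\<forall>j\<in>{1..n}. fps_nth S j = fps_nth T j)"
proof -
  define E where "E = fps_of_poly (Q - P) - fps_const (1/2) * fps_of_poly Q * (S + T)"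
  have E0: "fps_nth E 0 \<noteq> 0" using M S T by (simp add: E_def M_def)
  have "quadratic (P, Q, R) S = quadratic (P, Q, R) S - quadratic (P, Q, R) T"
    by (simp only: quad) simp
  also have "\<dots> = (S - T) * E"
    by (simp add: E_def algebra_simps power2_eq_square)
  finally have eq: "quadratic (P, Q, R) S = (S - T) * E" .
  \<comment> \<open>Coefficient 0 vanishes on both sides of the equivalence, so ranges from 1 may be
    replaced by ranges from 0.\<close>
  have ends: "(\<forall>j\<in>{1..n}. A j) \<longleftrightarrow> (\<forall>j\<le>n. A j)" if "A 0" for A
  proof -
    have "{..n} = insert 0 {1..n}" by auto
    then show ?thesis using that by (metis atMost_iff insert_iff)
  qed
  show ?thesis
    using fps_mult_unit_nth_zero_iff[OF E0, of n "S - T"] S T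
    unfolding eq by (subst (1 2) ends) simp_all
qed

text \<open>Division is total, so nonvanishing of the denominator is asserted separately. The last
  clause makes precise how the triplet determines the initial values: the coefficients 1 to g + 1 of
  the quadratic equation characterise them.\<close>

theorem theorem3p8:
  fixes g :: nat and f P Q R :: "complex poly"
    and p q s w :: "nat \<Rightarrow> complex"
  assumes "g \<ge> 1" and "degree f \<le> 2 * g + 1" and "poly f 0 = 1"
    and "(P, Q, R) \<in> mu_fiber g f" and "generic (P, Q, R)"
    and "p = poly.coeff P" and "q = poly.coeff Q"
    and "w = w_seq (P, Q, R)"
    and "s = fps_nth (S_series (P, Q, R))"
  shows "(\<forall>n\<ge>1.
            Delta s (int n - 2) * Delta s (int n - 1) \<noteq> 0 \<and>
            w n = (Delta s (int n - 3) * Delta s (int n)) /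
                  (Delta s (int n - 2) * Delta s (int n - 1)))
       \<and> (\<forall>j\<ge>g + 2.
            s j = (\<Sum>k=1..g. (p k - q k) * s (j - k))
                + (\<Sum>i=1..j - 1. s i * s (j - i))
                + 1/2 * (\<Sum>k=1..g. q k * (\<Sum>i=1..j - k - 1. s i * s (j - k - i))))
       \<and> (\<forall>S. fps_nth S 0 = 0 \<longrightarrow>
            ((\<forall>j\<in>{1..g + 1}. fps_nth (quadratic (P, Q, R) S) j = 0)
             \<longleftrightarrow> (\<forall>j\<in>{1..g + 1}. fps_nth S j = s j)))"
proof -
  have M: "(P, Q, R) \<in> M g" using assms(4) by (simp add: mu_fiber_def)
  note Delta = w_seq_Delta[OF M assms(5), folded assms(8,9)]
  note S0 = S_series_0[OF M] and quad = quadratic_S_series[OF M]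
  have "Delta s (int n - 2) * Delta s (int n - 1) \<noteq> 0 \<and>
      w n = (Delta s (int n - 3) * Delta s (int n)) / (Delta s (int n - 2) * Delta s (int n - 1))"
    if "n \<ge> 1" for n
  proof -
    \<comment> \<open>With n = k + 1 the indices k - 2, k + 1, k - 1, k become n - 3, n, n - 2, n -
      1.\<close>
    from that obtain k where "n = Suc k" by (cases n) auto
    then show ?thesis using Delta(2)[of k] Delta(1) by (simp add: field_simps)
  qed
  then show ?thesis
    using quadratic_recursion[OF M S0 quad] quadratic_determines_initial[OF M _ S0 quad]
    unfolding assms(6,7,9) by blast
qed

end
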